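(* Let $n\ge1$ and $K,L\in\mathbb{N}$. Let $c$ be the signed channel $c=\mathrm{dmn}[K]\circ\mathrm{Dir}(\mathbf{1}+-)$ from $\mathcal{M}[L](\mathbf{n})$ to $\mathcal{M}[K](\mathbf{n})$, that is, $$c(\psi)(\varphi)=\int_{\vec r\in\Delta^n}\mathrm{dmn}[K](\vec r)(\varphi)\cdot\mathrm{dir}(\mathbf{1}+\psi)(\vec r)\,d\vec r .$$ 1. The following two joint signed distributions on $\mathcal{M}[K](\mathbf{n})\times\mathcal{M}[L](\mathbf{n})$ are equal: the one obtained by drawing $\varphi$ from the uniform distribution on $\mathcal{M}[K](\mathbf{n})$, and then $\psi$ from $\mathrm{mn}[L]\circ\mathrm{DDir}$ applied to $\varphi$; and the one obtained by drawing $\psi$ from the uniform distribution on $\mathcal{M}[L](\mathbf{n})$, and then $\varphi$ from $c(\psi)$. Explicitly, for all $\varphi\in\mathcal{M}[K](\mathbf{n})$ and $\psi\in\mathcal{M}[L](\mathbf{n})$, $$\frac{1}{\binom{n+K-1}{K}}\cdot\int_{\vec r\in\Delta^n}\mathfrak{m}_\psi(\vec r)\cdot\mathfrak{d}_\varphi(\vec r)\,d\vec r\;=\;\frac{1}{\binom{n+L-1}{L}}\cdot c(\psi)(\varphi).$$ 2. The signed hypergeometric channel $\mathrm{shg}[L]$ from $\mathcal{M}[K](\mathbf{n})$ to $\mathcal{M}[L](\mathbf{n})$ is the dagger (Bayesian inversion) of $c$ with the uniform distribution on $\mathcal{M}[L](\mathbf{n})$ as prior: $$\mathrm{shg}[L]=\big(\mathrm{dmn}[K]\circ\mathrm{Dir}(\mathbf{1}+-)\big)^{\dagger}_{\mathrm{uf}},\qquad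 \mathrm{uf}=\text{uniform distribution on }\mathcal{M}[L](\mathbf{n}).$$
   Context: For $n\ge1$ let $\mathbf{n}=\{0,\dots,n-1\}$. A multiset on $\mathbf{n}$ is a function $\varphi:\mathbf{n}\to\mathbb{N}$; its size is $\|\varphi\|=\sum_i\varphi(i)$, $\mathcal{M}[K](\mathbf{n})$ is the set of multisets of size $K$ (it has $\binom{n+K-1}{K}$ elements), $\varphi!=\prod_i\varphi(i)!$, and addition/subtraction of multisets is pointwise. $\mathbf{1}$ is the multiset on $\mathbf{n}$ with $\mathbf{1}(i)=1$ for all $i$. A signed distribution on a finite set $X$ is a function $\sigma:X\to\mathbb{R}$ with $\sum_x\sigma(x)=1$. A signed channel from $X$ to $Y$ assigns to each $x\in X$ a signed distribution $c(x)$ on $Y$. Dagger: for a signed channel $c$ from a finite set $X$ to a finite set $Y$ and a prior distribution $\omega$ on $X$, let $(c_*\omega)(y)=\sum_x\omega(x)\,c(x)(y)$; if $(c_*\omega)(y)\ne0$ for all $y\in Y$, the dagger $c^\dagger_\omega$ is the signed channel from $Y$ to $X$ given by $c^\dagger_\omega(y)(x)=\dfrac{\omega(x)\,c(x)(y)}{(c_*\omega)(y)}$. (The claim includes that this is defined.) Simplex: $\Delta^n=\{\vec r\in\mathbb{R}_{\ge0}^n\mid\sum_i r_i=1\}$. Integrals over $\Delta^n$ are with respect to Lebesgue measure in the coordinates $(r_0,\dots,r_{n-2})$ (a point mass $1$ if $n=1$), so that $\int_{\Delta^n}\prod_i r_i^{\varphi(i)}\,d\vec r=\frac{\varphi!}{(\|\varphi\|+n-1)!}$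 for every multiset $\varphi$. For $\varphi\in\mathcal{M}[K](\mathbf{n})$ let $\mathfrak{m}_\varphi:\Delta^n\to\mathbb{R}$, $\mathfrak{m}_\varphi(\vec r)=\frac{K!}{\varphi!}\prod_i r_i^{\varphi(i)}$; the multinomial channel is $\mathrm{mn}[K](\vec r)(\varphi)=\mathfrak{m}_\varphi(\vec r)$. Let $P_K(\Delta^n)$ be the real vector space of functions on $\Delta^n$ spanned by the $\mathfrak{m}_\varphi$, $\varphi\in\mathcal{M}[K](\mathbf{n})$ (these form a basis), with inner product $\langle f,g\rangle=\int_{\Delta^n}f(\vec r)g(\vec r)\,d\vec r$. The dual multinomials $(\mathfrak{d}_\psi)_{\psi\in\mathcal{M}[K](\mathbf{n})}$ are the unique elements of $P_K(\Delta^n)$ with $\langle\mathfrak{m}_\varphi,\mathfrak{d}_\psi\rangle=\delta_{\varphi,\psi}$ for all $\varphi,\psi\in\mathcal{M}[K](\mathbf{n})$. Thus for any multiset $\upsilon$, $\mathfrak{d}_\upsilon\in P_{\|\upsilon\|}(\Delta^n)$. Dual Dirichlet: $\mathrm{DDir}(\upsilon)$ is the signed measure on $\Delta^n$ with density $\mathfrak{d}_\upsilon$. Signed hypergeometric: $\mathrm{shg}[L]=\mathrm{mn}[L]\circ\mathrm{DDir}$, i.e. $\mathrm{shg}[L](\upsilon)(\psi)=\int_{\Delta^n}\mathfrak{m}_\psi(\vec r)\,\mathfrak{d}_\upsilon(\vec r)\,d\vec r$ for $\psi\in\mathcal{M}[L](\mathbf{n})$. Dirichlet: for a multiset $\upsilon$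 with $\upsilon(i)\ge1$ for all $i\in\mathbf{n}$, $\mathrm{Dir}(\upsilon)$ is the probability measure on $\Delta^n$ with density $\mathrm{dir}(\upsilon)(\vec r)=\frac{(\|\upsilon\|-1)!}{(\upsilon-\mathbf{1})!}\prod_i r_i^{\upsilon(i)-1}$. Dual multinomial distribution: for $\vec r\in\Delta^n$, $\mathrm{dmn}[K](\vec r)$ is the signed distribution on $\mathcal{M}[K](\mathbf{n})$ with $\mathrm{dmn}[K](\vec r)(\varphi)=\frac{K!}{(K+n-1)!}\cdot\mathfrak{d}_\varphi(\vec r)$. *)

theory Defs
  imports "HOL-Analysis.Analysis" "HOL-Library.Multiset"
begin

text \<open>
  Distributions on a finite set \<open>X\<close> and channels are total functions of which only the values
  on the carriers matter; equality of two of them means equality on the carriers.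
\<close>

definition signed_distribution :: "'a set \<Rightarrow> ('a \<Rightarrow> real) \<Rightarrow> bool" where
  "signed_distribution X \<sigma> \<longleftrightarrow> finite X \<and> (\<Sum>x\<in>X. \<sigma> x) = 1"

definition signed_channel :: "'a set \<Rightarrow> 'b set \<Rightarrow> ('a \<Rightarrow> 'b \<Rightarrow> real) \<Rightarrow> bool" where
  "signed_channel X Y c \<longleftrightarrow> finite X \<and> (\<forall>x\<in>X. signed_distribution Y (c x))"

definition uniform :: "'a set \<Rightarrow> 'a \<Rightarrow> real" where
  "uniform X x = 1 / real (card X)"

definition joint :: "('a \<Rightarrow> real) \<Rightarrow> ('a \<Rightarrow> 'b \<Rightarrow> real) \<Rightarrow> 'a \<times> 'b \<Rightarrow> real" where
  "joint \<omega> c = (\<lambda>(x, y). \<omega> x * c x y)"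

definition channel_push :: "'a set \<Rightarrow> ('a \<Rightarrow> 'b \<Rightarrow> real) \<Rightarrow> ('a \<Rightarrow> real) \<Rightarrow> 'b \<Rightarrow> real" where
  "channel_push X c \<omega> y = (\<Sum>x\<in>X. \<omega> x * c x y)"

definition dagger_defined ::
    "'a set \<Rightarrow> 'b set \<Rightarrow> ('a \<Rightarrow> 'b \<Rightarrow> real) \<Rightarrow> ('a \<Rightarrow> real) \<Rightarrow> bool" where
  "dagger_defined X Y c \<omega> \<longleftrightarrow> (\<forall>y\<in>Y. channel_push X c \<omega> y \<noteq> 0)"

text \<open>Meaningful only under \<open>dagger_defined\<close>, since \<open>x / 0 = 0\<close> in HOL.\<close>

definition dagger :: "'a set \<Rightarrow> ('a \<Rightarrow> 'b \<Rightarrow> real) \<Rightarrow> ('a \<Rightarrow> real) \<Rightarrow> 'b \<Rightarrow> 'a \<Rightarrow> real" where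
  "dagger X c \<omega> y x = \<omega> x * c x y / channel_push X c \<omega> y"

text \<open>A multiset \<open>\<phi>\<close> on \<open>{0, \<dots>, n - 1}\<close>, as a function, is \<open>count \<phi>\<close> on \<open>{..<n}\<close>.\<close>

definition msets :: "nat \<Rightarrow> nat \<Rightarrow> nat multiset set" where
  "msets n K = {\<phi>. set_mset \<phi> \<subseteq> {..<n} \<and> size \<phi> = K}"

definition mset_one :: "nat \<Rightarrow> nat multiset" where
  "mset_one n = mset_set {..<n}"

definition mset_fact :: "nat \<Rightarrow> nat multiset \<Rightarrow> real" where
  "mset_fact n \<phi> = (\<Prod>i<n. fact (count \<phi> i))"

text \<open>Vectors in \<open>\<real>\<^sup>n\<close> are functions in the extensional product \<open>{..<n} \<rightarrow>\<^sub>E UNIV\<close>.\<close>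

definition simplex_set :: "nat \<Rightarrow> (nat \<Rightarrow> real) set" where
  "simplex_set n = {r \<in> {..<n} \<rightarrow>\<^sub>E UNIV. (\<forall>i<n. 0 \<le> r i) \<and> (\<Sum>i<n. r i) = 1}"

text \<open>
  The inverse of the chart \<open>r \<mapsto> (r 0, \<dots>, r (n - 2))\<close>. For \<open>n = 1\<close> its domain is the
  one-point space \<open>{} \<rightarrow>\<^sub>E UNIV\<close>, on which the empty product measure is a point mass \<open>1\<close>.
\<close>

definition simplex_param :: "nat \<Rightarrow> (nat \<Rightarrow> real) \<Rightarrow> nat \<Rightarrow> real" where
  "simplex_param n s = (\<lambda>i\<in>{..<n}. if i < n - 1 then s i else 1 - (\<Sum>j<n - 1. s j))"

definition simplex_measure :: "nat \<Rightarrow> (nat \<Rightarrow> real) measure" where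
  "simplex_measure n =
     restrict_space
       (distr (PiM {..<n - 1} (\<lambda>_. lborel)) (PiM {..<n} (\<lambda>_. borel)) (simplex_param n))
       (simplex_set n)"

abbreviation simplex_integral :: "nat \<Rightarrow> ((nat \<Rightarrow> real) \<Rightarrow> real) \<Rightarrow> real" where
  "simplex_integral n f \<equiv> integral\<^sup>L (simplex_measure n) f"

definition multinom :: "nat \<Rightarrow> nat multiset \<Rightarrow> (nat \<Rightarrow> real) \<Rightarrow> real" where
  "multinom n \<phi> = (\<lambda>r\<in>simplex_set n. fact (size \<phi>) / mset_fact n \<phi> * (\<Prod>i<n. r i ^ count \<phi> i))"

text \<open>
  The linear span of the multinomials. Its elements are extensional, i.e. literally functions on
  the simplex, so that equality in \<open>simplex_polys n K\<close> is equality on the simplex.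
\<close>

definition simplex_polys :: "nat \<Rightarrow> nat \<Rightarrow> ((nat \<Rightarrow> real) \<Rightarrow> real) set" where
  "simplex_polys n K =
     {f. \<exists>a. f = (\<lambda>r\<in>simplex_set n. \<Sum>\<phi>\<in>msets n K. a \<phi> * multinom n \<phi> r)}"

definition simplex_inner ::
    "nat \<Rightarrow> ((nat \<Rightarrow> real) \<Rightarrow> real) \<Rightarrow> ((nat \<Rightarrow> real) \<Rightarrow> real) \<Rightarrow> real" where
  "simplex_inner n f g = simplex_integral n (\<lambda>r. f r * g r)"

definition dual_multinom :: "nat \<Rightarrow> nat multiset \<Rightarrow> (nat \<Rightarrow> real) \<Rightarrow> real" where
  "dual_multinom n \<upsilon> =
     (THE d. d \<in> simplex_polys n (size \<upsilon>) \<and>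
        (\<forall>\<phi>\<in>msets n (size \<upsilon>).
           simplex_inner n (multinom n \<phi>) d = (if \<phi> = \<upsilon> then 1 else 0)))"

text \<open>
  Signed hypergeometric channel: the composite of the multinomial channel with the
  dual Dirichlet channel, whose value at \<open>\<upsilon>\<close> is the signed measure with density
  \<open>dual_multinom n \<upsilon>\<close>. The size of the draw is that of \<open>\<psi>\<close>.
\<close>

definition shg :: "nat \<Rightarrow> nat multiset \<Rightarrow> nat multiset \<Rightarrow> real" where
  "shg n \<upsilon> \<psi> = simplex_integral n (\<lambda>r. multinom n \<psi> r * dual_multinom n \<upsilon> r)"

text \<open>The Dirichlet density; used only for \<open>\<upsilon>\<close> with \<open>count \<upsilon> i \<ge> 1\<close> for all \<open>i < n\<close>.\<close>

definition dir :: "nat \<Rightarrow> nat multiset \<Rightarrow> (nat \<Rightarrow> real) \<Rightarrow> real" where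
  "dir n \<upsilon> r = fact (size \<upsilon> - 1) / mset_fact n (\<upsilon> - mset_one n) * (\<Prod>i<n. r i ^ (count \<upsilon> i - 1))"

definition dmn :: "nat \<Rightarrow> nat \<Rightarrow> (nat \<Rightarrow> real) \<Rightarrow> nat multiset \<Rightarrow> real" where
  "dmn n K r \<phi> = fact K / fact (K + n - 1) * dual_multinom n \<phi> r"

text \<open>The composite of \<open>dmn n K\<close> with the Dirichlet channel at \<open>\<psi> \<mapsto> mset_one n + \<psi>\<close>.\<close>

definition dmn_dir :: "nat \<Rightarrow> nat \<Rightarrow> nat multiset \<Rightarrow> nat multiset \<Rightarrow> real" where
  "dmn_dir n K \<psi> \<phi> = simplex_integral n (\<lambda>r. dmn n K r \<phi> * dir n (mset_one n + \<psi>) r)"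

end

theory Submission
  imports Defs
begin

text \<open>
  On the simplex the density \<open>dir (1 + \<psi>)\<close> is \<open>(L + n - 1)! / L!\<close> times the multinomial of
  \<open>\<psi>\<close>, so both joint distributions are the same multiple of the integral of the multinomial of
  \<open>\<psi>\<close> against the dual multinomial of \<open>\<phi>\<close>. What remains is that the dual multinomials exist and
  that both channels are normalised. By the Dirichlet integral, the Gram matrix of the
  multinomials is, up to positive diagonal scaling, the matrix of the products
  \<open>\<Prod>i. (\<phi> i + \<psi> i)!\<close>, whose positive definiteness follows from the Vandermonde identity; this
  gives existence and uniqueness of the duals. The multinomials sum to \<open>1\<close> and all have the same
  integral, hence the dual multinomials sum to a constant; both normalisations follow.
\<close>

section \<open>The Dirichlet integral over the simplex\<close>

text \<open>Induction on \<open>b\<close> by integration by parts: \<open>?F\<close> vanishes at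
  both ends of the interval and trades a factor \<open>t - s\<close> for a factor \<open>s\<close>,
  so the induction hypothesis is used at \<open>a + 1\<close>.\<close>

lemma has_integral_beta_nat:
  fixes t :: real
  assumes "0 \<le> t"
  shows "((\<lambda>s. s ^ a * (t - s) ^ b) has_integral
    fact a * fact b / fact (a + b + 1) * t ^ (a + b + 1)) {0..t}"
proof (induction b arbitrary: a)
  case 0
  have "((\<lambda>s. s ^ a) has_integral (t ^ (a + 1) / (a + 1) - 0 ^ (a + 1) / (a + 1))) {0..t}"
    by (rule fundamental_theorem_of_calculus[OF assms])
      (auto intro!: derivative_eq_intros simp flip: has_real_derivative_iff_has_vector_derivative
        simp del: power_Suc)
  then show ?case
    by (simp del: of_nat_Suc)
next
  case (Suc b)
  let ?F = "\<lambda>s::real. s ^ (a + 1) * (t - s) ^ (b + 1) / (a + 1)"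
  let ?c = "real (b + 1) / real (a + 1)"
  have "((\<lambda>s. s ^ a * (t - s) ^ (b + 1) - ?c * (s ^ (a + 1) * (t - s) ^ b)) has_integral
      (?F t - ?F 0)) {0..t}"
  proof (rule fundamental_theorem_of_calculus[OF assms])
    fix s assume "s \<in> {0..t}"
    have "((\<lambda>s. s ^ (a + 1) * (t - s) ^ (b + 1)) has_real_derivative
        real (a + 1) * s ^ a * (t - s) ^ (b + 1)
          - s ^ (a + 1) * (real (b + 1) * (t - s) ^ b)) (at s within {0..t})"
      by (rule derivative_eq_intros refl)+ (simp_all add: algebra_simps del: power_Suc)
    from DERIV_cdivide[OF this, of "real (a + 1)"] have "(?F has_real_derivative
        (real (a + 1) * s ^ a * (t - s) ^ (b + 1)
          - s ^ (a + 1) * (real (b + 1) * (t - s) ^ b)) / (a + 1)) (at s within {0..t})" .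
    moreover have "(real (a + 1) * s ^ a * (t - s) ^ (b + 1)
          - s ^ (a + 1) * (real (b + 1) * (t - s) ^ b)) / (a + 1) =
        s ^ a * (t - s) ^ (b + 1) - ?c * (s ^ (a + 1) * (t - s) ^ b)"
      by (simp add: diff_divide_distrib del: of_nat_Suc of_nat_add)
    ultimately show "(?F has_vector_derivative
        s ^ a * (t - s) ^ (b + 1) - ?c * (s ^ (a + 1) * (t - s) ^ b)) (at s within {0..t})"
      by (simp flip: has_real_derivative_iff_has_vector_derivative)
  qed
  from has_integral_add[OF this has_integral_mult_right[OF Suc.IH[of "a + 1"], of ?c]]
  have "((\<lambda>s. s ^ a * (t - s) ^ (b + 1)) has_integral
      ?c * (fact (a + 1) * fact b / fact (a + 1 + b + 1) * t ^ (a + 1 + b + 1))) {0..t}"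
    by simp
  moreover have "?c * (fact (a + 1) * fact b / fact (a + 1 + b + 1) * t ^ (a + 1 + b + 1)) =
      fact a * fact (Suc b) / fact (a + Suc b + 1) * t ^ (a + Suc b + 1)"
  proof -
    have "p / q * (q * x * y / D * T) = x * (p * y) / D * T" if "q \<noteq> 0" for p q x y D T :: real
      using that by simp
    from this[of "real (a + 1)" "real (b + 1)" "fact a" "fact b"] show ?thesis
      by simp
  qed
  ultimately show ?case
    by (simp add: mult_ac)
qed

text \<open>Integrating out one coordinate \<open>y\<close> leaves an integral of the same kind with
  bound \<open>t - y\<close>, and the outer integral is then a Beta integral. This is why
  \<open>t\<close> is general and the slack \<open>t - sum s A\<close> carries its own exponent
  \<open>b\<close>. With nonnegative integrals the iteration needs only measurability.\<close>

lemma nn_integral_dirichlet: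
  fixes a :: "'i \<Rightarrow> nat" and t :: real
  assumes "finite A" "0 \<le> t"
  shows "(\<integral>\<^sup>+ s. (if (\<forall>i\<in>A. 0 \<le> s i) \<and> sum s A \<le> t
        then ennreal ((\<Prod>i\<in>A. s i ^ a i) * (t - sum s A) ^ b) else 0) \<partial>PiM A (\<lambda>_. lborel)) =
    ennreal ((\<Prod>i\<in>A. fact (a i)) * fact b / fact (card A + sum a A + b)
      * t ^ (card A + sum a A + b))"
  using assms
proof (induction A arbitrary: t rule: finite_induct)
  case empty
  then show ?case
    by (simp add: PiM_empty nn_integral_count_space_finite)
next
  case (insert j A)
  interpret product_sigma_finite "\<lambda>_. lborel :: real measure"
    by standard
  note [simp] = insert.hyps
  let ?g = "\<lambda>A t s. if (\<forall>i\<in>A. 0 \<le> s i) \<and> sum s A \<le> t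
        then ennreal ((\<Prod>i\<in>A. s i ^ a i) * (t - sum s A) ^ b) else 0"
  let ?N = "card A + sum a A + b"
  let ?c = "(\<Prod>i\<in>A. fact (a i)) * fact b / fact ?N :: real"
  have meas: "?g B u \<in> borel_measurable (PiM B (\<lambda>_. lborel))" if [simp]: "finite B"
    for B :: "'i set" and u :: real
    by measurable
  have "(\<integral>\<^sup>+ s. ?g (insert j A) t s \<partial>PiM (insert j A) (\<lambda>_. lborel)) =
      (\<integral>\<^sup>+ y. (\<integral>\<^sup>+ s. ?g (insert j A) t (s(j := y)) \<partial>PiM A (\<lambda>_. lborel)) \<partial>lborel)"
    by (rule product_nn_integral_insert_rev) (use insert.hyps meas in auto)
  also have "\<dots> = (\<integral>\<^sup>+ y. ennreal (?c * (y ^ a j * (t - y) ^ ?N)) * indicator {0..t} y \<partial>lborel)"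
  proof (rule nn_integral_cong)
    fix y :: real
    have "(\<Sum>i\<in>A. (s(j := y)) i) = sum s A"
        "(\<Prod>i\<in>A. (s(j := y)) i ^ a i) = (\<Prod>i\<in>A. s i ^ a i)" for s :: "'i \<Rightarrow> real"
      using \<open>j \<notin> A\<close> by (auto intro!: sum.cong prod.cong)
    then have upd: "sum (s(j := y)) (insert j A) = y + sum s A"
        "(\<Prod>i\<in>insert j A. (s(j := y)) i ^ a i) = y ^ a j * (\<Prod>i\<in>A. s i ^ a i)"
        "(\<forall>i\<in>insert j A. 0 \<le> (s(j := y)) i) \<longleftrightarrow> 0 \<le> y \<and> (\<forall>i\<in>A. 0 \<le> s i)"
      for s :: "'i \<Rightarrow> real"
      using \<open>j \<notin> A\<close> \<open>finite A\<close> by (auto simp del: fun_upd_apply) (auto split: if_splits)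
    show "(\<integral>\<^sup>+ s. ?g (insert j A) t (s(j := y)) \<partial>PiM A (\<lambda>_. lborel)) =
        ennreal (?c * (y ^ a j * (t - y) ^ ?N)) * indicator {0..t} y"
    proof (cases "y \<in> {0..t}")
      case True
      have "?g (insert j A) t (s(j := y)) = ennreal (y ^ a j) * ?g A (t - y) s" for s
        using True by (auto simp only: upd diff_diff_eq mult.assoc ennreal_mult' zero_le_power
            atLeastAtMost_iff le_diff_eq add.commute mult_zero_right split: if_split)
      then have "(\<integral>\<^sup>+ s. ?g (insert j A) t (s(j := y)) \<partial>PiM A (\<lambda>_. lborel)) =
          ennreal (y ^ a j) * (\<integral>\<^sup>+ s. ?g A (t - y) s \<partial>PiM A (\<lambda>_. lborel))"
        by (simp only: nn_integral_cmult[OF meas[OF \<open>finite A\<close>]])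
      also have "\<dots> = ennreal (y ^ a j) * ennreal (?c * (t - y) ^ ?N)"
        using True by (subst insert.IH) auto
      finally show ?thesis
        using True by (simp add: mult_ac flip: ennreal_mult')
    next
      case False
      \<comment> \<open>For \<open>y < 0\<close> the sign condition fails; for \<open>y > t\<close>
        nonnegative remaining coordinates push the sum above \<open>t\<close>.\<close>
      have "?g (insert j A) t (s(j := y)) = 0" for s
        using False by (auto simp only: upd split: if_split) (smt (verit) sum_nonneg atLeastAtMost_iff)
      then show ?thesis
        using False by simp
    qed
  qed
  also have "\<dots> = ennreal (?c * (fact (a j) * fact ?N / fact (a j + ?N + 1) * t ^ (a j + ?N + 1)))"
  proof (rule nn_integral_has_integral_lebesgue')
    fix y assume "y \<in> {0..t}"
    then show "0 \<le> ?c * (y ^ a j * (t - y) ^ ?N)"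
      by (auto intro!: mult_nonneg_nonneg divide_nonneg_nonneg prod_nonneg)
  next
    show "((\<lambda>y. ?c * (y ^ a j * (t - y) ^ ?N)) has_integral
        ?c * (fact (a j) * fact ?N / fact (a j + ?N + 1) * t ^ (a j + ?N + 1))) {0..t}"
      by (rule has_integral_mult_right[OF has_integral_beta_nat[OF insert.prems]])
  qed
  also have "?c * (fact (a j) * fact ?N / fact (a j + ?N + 1) * t ^ (a j + ?N + 1)) =
      (\<Prod>i\<in>insert j A. fact (a i)) * fact b / fact (card (insert j A) + sum a (insert j A) + b)
      * t ^ (card (insert j A) + sum a (insert j A) + b)"
    by (simp add: add_ac del: fact_Suc)
  finally show ?case .
qed

lemma space_simplex_measure [simp]: "space (simplex_measure n) = simplex_set n"
  by (auto simp: simplex_measure_def space_restrict_space simplex_set_def space_PiM)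

lemma simplex_set_measurable: "simplex_set n \<in> sets (PiM {..<n} (\<lambda>_. borel))"
proof -
  have "simplex_set n = {r \<in> space (PiM {..<n} (\<lambda>_. borel :: real measure)).
      (\<forall>i\<in>{..<n}. 0 \<le> r i) \<and> (\<Sum>i\<in>{..<n}. r i) = 1}"
    by (auto simp: simplex_set_def space_PiM)
  also have "\<dots> \<in> sets (PiM {..<n} (\<lambda>_. borel))"
    by measurable
  finally show ?thesis .
qed

lemma simplex_param_measurable:
  "simplex_param n \<in> measurable (PiM {..<n - 1} (\<lambda>_. lborel)) (PiM {..<n} (\<lambda>_. borel))"
  unfolding simplex_param_def
proof (rule measurable_restrict)
  fix i assume "i \<in> {..<n}"
  show "(\<lambda>s. if i < n - 1 then s i else 1 - (\<Sum>j<n - 1. s j))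
      \<in> borel_measurable (PiM {..<n - 1} (\<lambda>_. lborel))"
    by (cases "i < n - 1") (auto intro!: measurable_component_singleton)
qed

lemma nn_integral_simplex_measure:
  assumes [measurable]: "f \<in> borel_measurable (PiM {..<n} (\<lambda>_. borel))"
  shows "integral\<^sup>N (simplex_measure n) f =
    (\<integral>\<^sup>+ s. f (simplex_param n s) * indicator (simplex_set n) (simplex_param n s)
      \<partial>PiM {..<n - 1} (\<lambda>_. lborel))"
proof -
  note [measurable] = simplex_set_measurable simplex_param_measurable
  show ?thesis
    unfolding simplex_measure_def
    by (subst nn_integral_restrict_space, simp, subst nn_integral_distr) measurable
qed

text \<open>The last coordinate is chosen so that the sum is always 1; only the signs remain, and
  nonnegativity of the last coordinate is the bound on the sum of the others.\<close>

lemma simplex_param_in_simplex_set_iff: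
  assumes "n \<ge> 1"
  shows "simplex_param n s \<in> simplex_set n \<longleftrightarrow>
    (\<forall>i\<in>{..<n - 1}. 0 \<le> s i) \<and> sum s {..<n - 1} \<le> 1"
proof -
  obtain m where n: "n = Suc m"
    using assms by (cases n) auto
  have "(\<Sum>i<n. simplex_param n s i) = 1"
    by (simp add: n simplex_param_def)
  then show ?thesis
    by (force simp: simplex_set_def n simplex_param_def less_Suc_eq)
qed

lemma has_bochner_integral_simplex_monomial:
  fixes a :: "nat \<Rightarrow> nat"
  assumes "n \<ge> 1"
  shows "has_bochner_integral (simplex_measure n) (\<lambda>r. \<Prod>i<n. r i ^ a i)
    ((\<Prod>i<n. fact (a i)) / fact ((\<Sum>i<n. a i) + n - 1))"
proof (rule has_bochner_integral_nn_integral)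
  obtain m where n: "n = Suc m"
    using assms by (cases n) auto
  have meas: "(\<lambda>r. \<Prod>i<n. r i ^ a i) \<in> borel_measurable (PiM {..<n} (\<lambda>_. borel :: real measure))"
    by measurable
  then show "(\<lambda>r. \<Prod>i<n. r i ^ a i) \<in> borel_measurable (simplex_measure n)"
    unfolding simplex_measure_def by (intro measurable_restrict_space1) simp
  show "AE r in simplex_measure n. 0 \<le> (\<Prod>i<n. r i ^ a i)"
    by (rule AE_I2) (auto simp: simplex_set_def intro!: prod_nonneg)
  show "0 \<le> (\<Prod>i<n. fact (a i)) / (fact ((\<Sum>i<n. a i) + n - 1) :: real)"
    by (auto intro!: divide_nonneg_nonneg prod_nonneg)
  have "(\<integral>\<^sup>+ r. ennreal (\<Prod>i<n. r i ^ a i) \<partial>simplex_measure n) =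
    (\<integral>\<^sup>+ s. ennreal (\<Prod>i<n. simplex_param n s i ^ a i)
        * indicator (simplex_set n) (simplex_param n s) \<partial>PiM {..<n - 1} (\<lambda>_. lborel))"
    using meas by (intro nn_integral_simplex_measure) measurable
  also have "\<dots> = (\<integral>\<^sup>+ s. (if (\<forall>i\<in>{..<m}. 0 \<le> s i) \<and> sum s {..<m} \<le> 1
        then ennreal ((\<Prod>i\<in>{..<m}. s i ^ a i) * (1 - sum s {..<m}) ^ a m) else 0)
      \<partial>PiM {..<m} (\<lambda>_. lborel))"
  proof -
    have "(\<Prod>i<n. simplex_param n s i ^ a i) =
        (\<Prod>i\<in>{..<m}. s i ^ a i) * (1 - sum s {..<m}) ^ a m" for s
      by (simp add: n simplex_param_def)
    then show ?thesis
      using simplex_param_in_simplex_set_iff[OF assms]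
      by (auto simp: n indicator_def intro!: nn_integral_cong)
  qed
  also have "\<dots> = ennreal ((\<Prod>i<n. fact (a i)) / fact ((\<Sum>i<n. a i) + n - 1))"
    \<comment> \<open>The last coordinate is the slack, so \<open>t = 1\<close> and
      \<open>b = a m\<close>.\<close>
    by (subst nn_integral_dirichlet) (simp_all add: n add_ac)
  finally show "(\<integral>\<^sup>+ r. ennreal (\<Prod>i<n. r i ^ a i) \<partial>simplex_measure n) =
      ennreal ((\<Prod>i<n. fact (a i)) / fact ((\<Sum>i<n. a i) + n - 1))" .
qed

section \<open>Multisets of fixed size and the multinomial theorem\<close>

lemma msets_eq: "msets n K = multisets_of_size {..<n} K"
  by (simp add: msets_def multisets_of_size_def)

lemma finite_msets [simp]: "finite (msets n K)"
  by (auto simp: msets_eq)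

lemma card_msets: "card (msets n K) = (n + K - 1) choose K"
  by (simp add: msets_eq card_multisets_of_size)

lemma sum_count_msets:
  assumes "\<phi> \<in> msets n K"
  shows "(\<Sum>i<n. count \<phi> i) = K"
proof -
  have "(\<Sum>i\<in>set_mset \<phi>. count \<phi> i) = (\<Sum>i<n. count \<phi> i)"
    using assms by (intro sum.mono_neutral_left) (auto simp: msets_def not_in_iff)
  then show ?thesis
    using assms by (simp add: msets_def size_multiset_overloaded_eq)
qed

text \<open>Strict inclusion would lower the size. Contrapositively, distinct multisets of equal
  size each fall below the other at some index, which is how off-diagonal terms are killed in
  \<open>pos_def_on_prod_fact\<close>.\<close>

lemma msets_eqI:
  assumes "\<phi> \<in> msets n K" "\<psi> \<in> msets n K" "\<And>i. i < n \<Longrightarrow> count \<phi> i \<le> count \<psi> i"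
  shows "\<phi> = \<psi>"
proof -
  have "\<phi> \<subseteq># \<psi>"
  proof (rule mset_subset_eqI)
    fix i
    show "count \<phi> i \<le> count \<psi> i"
    proof (cases "i < n")
      case False
      then have "i \<notin># \<phi>"
        using assms(1) by (auto simp: msets_def)
      then show ?thesis
        by (simp add: not_in_iff)
    qed (rule assms(3))
  qed
  then show ?thesis
    using assms(1,2) by (auto simp: msets_def subset_mset.le_less dest: mset_subset_size)
qed

text \<open>Induction on \<open>n\<close>: divided by factorials, the terms are multiplicative in
  the multiplicity \<open>m\<close> of the last index, and the sum over \<open>m\<close> is a
  binomial expansion.\<close>

lemma multinomial_theorem_msets:
  fixes r :: "nat \<Rightarrow> real"
  shows "(\<Sum>\<phi>\<in>msets n K. (\<Prod>i<n. r i ^ count \<phi> i) / mset_fact n \<phi>) = (\<Sum>i<n. r i) ^ K / fact K"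
proof (induction n arbitrary: K)
  case 0
  then show ?case
    by (cases "K = 0") (auto simp: msets_eq mset_fact_def)
next
  case (Suc n)
  let ?f = "\<lambda>n \<phi>. (\<Prod>i<n. r i ^ count \<phi> i) / mset_fact n \<phi>"
  have f: "?f (Suc n) (\<phi> + replicate_mset m n) = r n ^ m / fact m * ?f n \<phi>"
    if "\<phi> \<in> msets n (K - m)" for \<phi> m
  proof -
    have "count \<phi> n = 0"
      using that by (auto simp: msets_def not_in_iff[symmetric])
    then show ?thesis
      by (simp add: mset_fact_def mult_ac)
  qed
  \<comment> \<open>A multiset splits uniquely into \<open>m\<close> copies of \<open>n\<close> and
    a multiset of size \<open>K - m\<close> on the smaller indices.\<close>
  have "(\<Sum>\<phi>\<in>msets (Suc n) K. ?f (Suc n) \<phi>) =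
      (\<Sum>(m, \<phi>)\<in>(SIGMA m:{0..K}. msets n (K - m)). ?f (Suc n) (\<phi> + replicate_mset m n))"
    unfolding msets_eq lessThan_Suc
    using sum.reindex_bij_betw[OF bij_betw_multisets_of_size_insert[of n "{..<n}" K], of "?f (Suc n)"]
    by (simp add: case_prod_unfold lessThan_Suc)
  also have "\<dots> = (\<Sum>m=0..K. \<Sum>\<phi>\<in>msets n (K - m). ?f (Suc n) (\<phi> + replicate_mset m n))"
    by (rule sum.Sigma[symmetric]) simp_all
  also have "\<dots> = (\<Sum>m=0..K. \<Sum>\<phi>\<in>msets n (K - m). r n ^ m / fact m * ?f n \<phi>)"
    by (intro sum.cong refl f)
  also have "\<dots> = (\<Sum>m=0..K. r n ^ m / fact m * ((\<Sum>i<n. r i) ^ (K - m) / fact (K - m)))"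
    by (simp only: sum_distrib_left[symmetric] Suc.IH)
  also have "\<dots> = (\<Sum>m\<le>K. real (K choose m) * r n ^ m * (\<Sum>i<n. r i) ^ (K - m)) / fact K"
    by (simp add: sum_divide_distrib atMost_atLeast0 binomial_fact)
  also have "\<dots> = (\<Sum>i<Suc n. r i) ^ K / fact K"
    by (subst binomial_ring[symmetric]) (simp add: add.commute)
  finally show ?case .
qed

section \<open>Positive definite forms and the factorial matrix\<close>

text \<open>Vandermonde's identity, read as an inner product of the vectors
  \<open>fact i * (i choose k)\<close> and \<open>fact j * (j choose k)\<close> indexed by
  \<open>k\<close>. Terms with \<open>k > i\<close> vanish, so one range \<open>N\<close> can serve
  all \<open>i\<close> at once.\<close>

lemma fact_add_eq_sum:
  assumes "i \<le> N"
  shows "fact (i + j) = (\<Sum>k\<le>N. fact i * real (i choose k) * (fact j * real (j choose k)))"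
proof -
  have "(i + j) choose i = (\<Sum>k\<le>i. (j choose k) * (i choose (i - k)))"
    by (subst vandermonde) (simp add: add.commute)
  also have "\<dots> = (\<Sum>k\<le>i. (i choose k) * (j choose k))"
    by (intro sum.cong refl) (auto simp: binomial_symmetric[symmetric])
  also have "\<dots> = (\<Sum>k\<le>N. (i choose k) * (j choose k))"
    using assms by (intro sum.mono_neutral_left) auto
  finally have "real ((i + j) choose i) = (\<Sum>k\<le>N. real (i choose k) * real (j choose k))"
    by simp
  then have "fact (i + j) = fact i * fact j * (\<Sum>k\<le>N. real (i choose k) * real (j choose k))"
    by (simp add: binomial_fact field_simps)
  then show ?thesis
    by (simp add: sum_distrib_left mult_ac)
qed

text \<open>Stated over an arbitrary index set, so that linear systems can be solved by induction on
  that set.\<close>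

definition pos_def_on :: "'a set \<Rightarrow> ('a \<Rightarrow> 'a \<Rightarrow> real) \<Rightarrow> bool" where
  "pos_def_on S G \<longleftrightarrow>
    (\<forall>a. (\<Sum>x\<in>S. \<Sum>y\<in>S. a x * G x y * a y) \<le> 0 \<longrightarrow> (\<forall>x\<in>S. a x = 0))"

text \<open>Extending a vector by zero leaves the quadratic form unchanged.\<close>

lemma pos_def_on_subset:
  assumes "pos_def_on T G" "finite T" "S \<subseteq> T"
  shows "pos_def_on S G"
  unfolding pos_def_on_def
proof (intro allI impI)
  fix a assume a: "(\<Sum>x\<in>S. \<Sum>y\<in>S. a x * G x y * a y) \<le> 0"
  let ?a = "\<lambda>x. if x \<in> S then a x else 0"
  have "(\<Sum>x\<in>T. \<Sum>y\<in>T. ?a x * G x y * ?a y) = (\<Sum>x\<in>S. \<Sum>y\<in>S. a x * G x y * a y)"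
    using assms(2,3) by (intro sum.mono_neutral_cong_right ballI) auto
  then have "\<forall>x\<in>T. ?a x = 0"
    using a by (intro assms(1)[unfolded pos_def_on_def, THEN spec[of _ ?a], THEN mp]) simp
  then show "\<forall>x\<in>S. a x = 0"
    using assms(3) by (auto dest: subsetD split: if_splits)
qed

text \<open>Gaussian elimination with one new index \<open>s\<close> at a time; definiteness
  guarantees that the new pivot is nonzero.\<close>

lemma pos_def_on_solve:
  assumes "finite S" "pos_def_on S G"
  shows "\<exists>a. \<forall>x\<in>S. (\<Sum>y\<in>S. G x y * a y) = v x"
  using assms
proof (induction S arbitrary: v rule: finite_induct)
  case empty
  then show ?case
    by simp
next
  case (insert s S)
  have "pos_def_on S G"
    using insert.prems by (rule pos_def_on_subset) (use insert.hyps in auto)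
  note IH = insert.IH[OF this]
  obtain b where b: "\<And>x. x \<in> S \<Longrightarrow> (\<Sum>y\<in>S. G x y * b y) = G x s"
    using IH[of "\<lambda>x. G x s"] by auto
  obtain c where c: "\<And>x. x \<in> S \<Longrightarrow> (\<Sum>y\<in>S. G x y * c y) = v x"
    using IH[of v] by auto
  \<comment> \<open>\<open>p\<close> is the Schur complement of the block over \<open>S\<close>; if
    it were zero, \<open>w\<close> would be a kernel vector with entry 1 at
    \<open>s\<close>.\<close>
  define w where "w x = (if x = s then 1 else - b x)" for x
  define p where "p = G s s - (\<Sum>y\<in>S. G s y * b y)"
  have ne: "x \<noteq> s" if "x \<in> S" for x
    using that insert.hyps by auto
  \<comment> \<open>Used twice: with \<open>t = 1\<close> and \<open>c = 0\<close> it gives the rows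
    of \<open>w\<close>, and with the solution \<open>c\<close> over \<open>S\<close> it gives the
    rows of the final solution.\<close>
  have split: "(\<Sum>y\<in>insert s S. G x y * (if y = s then t else c y - t * b y)) =
      (\<Sum>y\<in>S. G x y * c y) + t * (G x s - (\<Sum>y\<in>S. G x y * b y))" for x t and c :: "'a \<Rightarrow> real"
  proof -
    have "(\<Sum>y\<in>S. G x y * (if y = s then t else c y - t * b y)) =
        (\<Sum>y\<in>S. G x y * c y - t * (G x y * b y))"
      by (intro sum.cong) (auto simp: ne algebra_simps)
    then show ?thesis
      using insert.hyps by (simp add: sum_subtractf sum_distrib_left algebra_simps)
  qed
  have "p \<noteq> 0"
  proof
    assume "p = 0"
    have row: "(\<Sum>y\<in>insert s S. G x y * w y) = 0" if "x \<in> insert s S" for x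
      using split[of x 1 "\<lambda>_. 0"] that \<open>p = 0\<close> b[of x]
      by (auto simp: w_def p_def cong: if_cong)
    have "(\<Sum>x\<in>insert s S. \<Sum>y\<in>insert s S. w x * G x y * w y) =
        (\<Sum>x\<in>insert s S. w x * (\<Sum>y\<in>insert s S. G x y * w y))"
      by (simp only: sum_distrib_left mult.assoc)
    also have "\<dots> = 0"
      using row by (intro sum.neutral) simp
    finally have "\<forall>x\<in>insert s S. w x = 0"
      by (intro insert.prems[unfolded pos_def_on_def, THEN spec[of _ w], THEN mp] eq_refl)
    then show False
      by (simp add: w_def)
  qed
  \<comment> \<open>Rows in \<open>S\<close> hold for every \<open>t\<close> by the choice of
    \<open>b\<close> and \<open>c\<close>; this value makes row \<open>s\<close> hold.\<close>
  define t where "t = (v s - (\<Sum>y\<in>S. G s y * c y)) / p"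
  have "(\<Sum>y\<in>insert s S. G x y * (if y = s then t else c y - t * b y)) = v x"
    if "x \<in> insert s S" for x
    unfolding split using that \<open>p \<noteq> 0\<close> b[of x] c[of x]
    by (cases "x = s") (simp_all add: t_def p_def[symmetric])
  then show ?case
    by (intro exI[of _ "\<lambda>y. if y = s then t else c y - t * b y"]) auto
qed

text \<open>
  The Vandermonde identity turns each factor \<open>(i + j)!\<close> into a Gram matrix; on index tuples of
  total size \<open>K\<close> the corresponding feature map is already diagonal, which gives definiteness.
\<close>

lemma pos_def_on_prod_fact:
  "pos_def_on (msets n K) (\<lambda>\<phi> \<psi>. \<Prod>i<n. fact (count \<phi> i + count \<psi> i))"
  unfolding pos_def_on_def
proof (intro allI impI ballI)
  fix a \<kappa>
  assume le: "(\<Sum>\<phi>\<in>msets n K. \<Sum>\<psi>\<in>msets n K.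
      a \<phi> * (\<Prod>i<n. fact (count \<phi> i + count \<psi> i)) * a \<psi>) \<le> (0::real)"
    and \<kappa>: "\<kappa> \<in> msets n K"
  \<comment> \<open>\<open>F \<phi>\<close> is the feature vector of \<phi>: the product over
    \<open>i\<close> of the vectors from \<open>fact_add_eq_sum\<close>, indexed by tuples
    \<open>k\<close>. The quadratic form becomes a sum of squares over \<open>?P\<close>.\<close>
  define F where "F \<phi> k = (\<Prod>i<n. fact (count \<phi> i) * real (count \<phi> i choose k i))" for \<phi> k
  let ?P = "{..<n} \<rightarrow>\<^sub>E {..K}"
  have count_le: "count \<phi> i \<le> K" if "\<phi> \<in> msets n K" for \<phi> i
    using that count_le_size[of \<phi> i] by (simp add: msets_def)
  have fin: "finite ?P"
    by (simp add: finite_PiE)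
  have "(\<Prod>i<n. fact (count \<phi> i + count \<psi> i)) = (\<Sum>k\<in>?P. F \<phi> k * F \<psi> k)"
    if "\<phi> \<in> msets n K" for \<phi> \<psi>
  proof -
    have "(\<Prod>i<n. fact (count \<phi> i + count \<psi> i)) =
        (\<Prod>i<n. \<Sum>k\<le>K. fact (count \<phi> i) * real (count \<phi> i choose k)
          * (fact (count \<psi> i) * real (count \<psi> i choose k)))"
      by (intro prod.cong refl fact_add_eq_sum count_le that)
    also have "\<dots> = (\<Sum>k\<in>?P. \<Prod>i<n. fact (count \<phi> i) * real (count \<phi> i choose k i)
          * (fact (count \<psi> i) * real (count \<psi> i choose k i)))"
      by (rule prod_sum_PiE) auto
    finally show ?thesis
      by (simp only: F_def prod.distrib)
  qed
  then have "(\<Sum>\<phi>\<in>msets n K. \<Sum>\<psi>\<in>msets n K.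
      a \<phi> * (\<Prod>i<n. fact (count \<phi> i + count \<psi> i)) * a \<psi>) =
    (\<Sum>\<phi>\<in>msets n K. \<Sum>\<psi>\<in>msets n K. \<Sum>k\<in>?P. (a \<phi> * F \<phi> k) * (a \<psi> * F \<psi> k))"
    by (simp add: sum_distrib_left sum_distrib_right mult_ac)
  also have "\<dots> = (\<Sum>\<phi>\<in>msets n K. \<Sum>k\<in>?P. \<Sum>\<psi>\<in>msets n K. (a \<phi> * F \<phi> k) * (a \<psi> * F \<psi> k))"
    by (intro sum.cong refl sum.swap)
  also have "\<dots> = (\<Sum>k\<in>?P. \<Sum>\<phi>\<in>msets n K. \<Sum>\<psi>\<in>msets n K. (a \<phi> * F \<phi> k) * (a \<psi> * F \<psi> k))"
    by (rule sum.swap)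
  also have "\<dots> = (\<Sum>k\<in>?P. (\<Sum>\<phi>\<in>msets n K. a \<phi> * F \<phi> k)\<^sup>2)"
    by (simp only: power2_eq_square sum_product)
  finally have "(\<Sum>k\<in>?P. (\<Sum>\<phi>\<in>msets n K. a \<phi> * F \<phi> k)\<^sup>2) = 0"
    using le by (simp add: sum_nonneg antisym)
  moreover have "restrict (count \<kappa>) {..<n} \<in> ?P"
    using count_le[OF \<kappa>] by auto
  ultimately have "(\<Sum>\<phi>\<in>msets n K. a \<phi> * F \<phi> (restrict (count \<kappa>) {..<n})) = 0"
    using fin by (subst (asm) sum_nonneg_eq_0_iff) auto
  \<comment> \<open>At the tuple given by \<kappa>, a nonzero feature requires
    \<open>count \<kappa> i \<le> count \<phi> i\<close> for all \<open>i < n\<close>, which equal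
    size allows only for \<phi> = \<kappa>.\<close>
  moreover have "F \<phi> (restrict (count \<kappa>) {..<n}) = 0"
    if \<phi>: "\<phi> \<in> msets n K" "\<phi> \<noteq> \<kappa>" for \<phi>
  proof -
    obtain i where "i < n" "count \<phi> i < count \<kappa> i"
      using msets_eqI[OF \<phi>(1) \<kappa>] msets_eqI[OF \<kappa> \<phi>(1)] \<phi>(2) by (metis not_le)
    then show ?thesis
      unfolding F_def by (intro prod_zero) auto
  qed
  then have "(\<Sum>\<phi>\<in>msets n K. a \<phi> * F \<phi> (restrict (count \<kappa>) {..<n})) =
      a \<kappa> * F \<kappa> (restrict (count \<kappa>) {..<n})"
    using \<kappa> by (subst sum.remove[OF _ \<kappa>]) auto
  moreover have "F \<kappa> (restrict (count \<kappa>) {..<n}) \<noteq> 0"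
    by (simp add: F_def)
  ultimately show "a \<kappa> = 0"
    by simp
qed

section \<open>Multinomials and their Gram matrix\<close>

lemma mset_fact_pos [simp]: "0 < mset_fact n \<phi>"
  by (simp add: mset_fact_def prod_pos)

lemma mset_fact_nonzero [simp]: "mset_fact n \<phi> \<noteq> 0"
  using mset_fact_pos[of n \<phi>] by linarith

lemma multinom_eq:
  "r \<in> simplex_set n \<Longrightarrow> \<phi> \<in> msets n K \<Longrightarrow>
    multinom n \<phi> r = fact K / mset_fact n \<phi> * (\<Prod>i<n. r i ^ count \<phi> i)"
  by (simp add: multinom_def msets_def)

lemma sum_multinom:
  assumes "r \<in> simplex_set n"
  shows "(\<Sum>\<phi>\<in>msets n K. multinom n \<phi> r) = 1"
proof -
  have "(\<Sum>\<phi>\<in>msets n K. multinom n \<phi> r) =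
      fact K * (\<Sum>\<phi>\<in>msets n K. (\<Prod>i<n. r i ^ count \<phi> i) / mset_fact n \<phi>)"
    by (simp add: sum_distrib_left multinom_eq[OF assms])
  also have "\<dots> = 1"
    using assms by (simp add: multinomial_theorem_msets simplex_set_def)
  finally show ?thesis .
qed

text \<open>The factor \<open>mset_fact n \<phi>\<close> of the Dirichlet integral cancels the one
  in the coefficient, so all multinomials of size \<open>K\<close> have the same mass.\<close>

lemma integral_multinom:
  assumes "n \<ge> 1" "\<phi> \<in> msets n K"
  shows "simplex_integral n (multinom n \<phi>) = fact K / fact (K + n - 1)"
proof -
  have "simplex_integral n (multinom n \<phi>) =
      simplex_integral n (\<lambda>r. fact K / mset_fact n \<phi> * (\<Prod>i<n. r i ^ count \<phi> i))"
    using assms(2) by (intro Bochner_Integration.integral_cong) (simp_all add: multinom_eq)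
  also have "\<dots> = fact K / mset_fact n \<phi> * (mset_fact n \<phi> / fact (K + n - 1))"
    using has_bochner_integral_simplex_monomial[OF assms(1), of "count \<phi>"] sum_count_msets[OF assms(2)]
    by (simp add: has_bochner_integral_iff mset_fact_def)
  finally show ?thesis
    by simp
qed

text \<open>The inner products of multinomials in closed form. The sizes may differ, since draws of
  size \<open>L\<close> are paired with urns of size \<open>K\<close>.\<close>

definition multinom_gram :: "nat \<Rightarrow> nat multiset \<Rightarrow> nat multiset \<Rightarrow> real" where
  "multinom_gram n \<phi> \<psi> = fact (size \<phi>) * fact (size \<psi>) / fact (size \<phi> + size \<psi> + n - 1)
    * ((\<Prod>i<n. fact (count \<phi> i + count \<psi> i)) / (mset_fact n \<phi> * mset_fact n \<psi>))"

lemma has_bochner_integral_multinom_mult: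
  assumes "n \<ge> 1" "\<phi> \<in> msets n K" "\<psi> \<in> msets n L"
  shows "has_bochner_integral (simplex_measure n) (\<lambda>r. multinom n \<phi> r * multinom n \<psi> r)
    (multinom_gram n \<phi> \<psi>)"
proof -
  have size: "size \<phi> = K" "size \<psi> = L"
    using assms by (auto simp: msets_def)
  have sum: "(\<Sum>i<n. count \<phi> i + count \<psi> i) = K + L"
    using assms by (simp add: sum.distrib sum_count_msets)
  have "has_bochner_integral (simplex_measure n)
      (\<lambda>r. fact K / mset_fact n \<phi> * (fact L / mset_fact n \<psi>)
        * (\<Prod>i<n. r i ^ (count \<phi> i + count \<psi> i)))
      (fact K / mset_fact n \<phi> * (fact L / mset_fact n \<psi>)
        * ((\<Prod>i<n. fact (count \<phi> i + count \<psi> i)) / fact (K + L + n - 1)))"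
    using has_bochner_integral_simplex_monomial[OF assms(1), of "\<lambda>i. count \<phi> i + count \<psi> i"]
    unfolding sum by (rule has_bochner_integral_mult_right)
  also have "?this \<longleftrightarrow> ?thesis"
    by (intro has_bochner_integral_cong)
      (simp_all add: multinom_eq[OF _ assms(2)] multinom_eq[OF _ assms(3)] multinom_gram_def size
        power_add prod.distrib mult_ac)
  finally show ?thesis .
qed

text \<open>For equal sizes this is a positive constant times the factorial matrix, scaled on both
  sides by the diagonal entries \<open>1 / mset_fact n \<phi>\<close>; the scaling is absorbed into
  the vector \<open>b\<close>.\<close>

lemma pos_def_on_multinom_gram: "pos_def_on (msets n K) (multinom_gram n)"
  unfolding pos_def_on_def
proof (intro allI impI)
  fix a
  assume le: "(\<Sum>\<phi>\<in>msets n K. \<Sum>\<psi>\<in>msets n K. a \<phi> * multinom_gram n \<phi> \<psi> * a \<psi>) \<le> 0"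
  define c :: real where "c = fact K * fact K / fact (K + K + n - 1)"
  define b where "b \<phi> = a \<phi> / mset_fact n \<phi>" for \<phi>
  have "c > 0"
    by (simp add: c_def)
  have "a \<phi> * multinom_gram n \<phi> \<psi> * a \<psi> =
      c * (b \<phi> * (\<Prod>i<n. fact (count \<phi> i + count \<psi> i)) * b \<psi>)"
    if "\<phi> \<in> msets n K" "\<psi> \<in> msets n K" for \<phi> \<psi>
  proof -
    have "size \<phi> = K" "size \<psi> = K"
      using that by (auto simp: msets_def)
    then show ?thesis
      by (simp add: multinom_gram_def b_def c_def)
  qed
  then have "(\<Sum>\<phi>\<in>msets n K. \<Sum>\<psi>\<in>msets n K. a \<phi> * multinom_gram n \<phi> \<psi> * a \<psi>) =
      c * (\<Sum>\<phi>\<in>msets n K. \<Sum>\<psi>\<in>msets n K.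
        b \<phi> * (\<Prod>i<n. fact (count \<phi> i + count \<psi> i)) * b \<psi>)"
    by (simp only: sum_distrib_left cong: sum.cong)
  with le \<open>c > 0\<close> have "\<forall>\<phi>\<in>msets n K. b \<phi> = 0"
    by (intro pos_def_on_prod_fact[unfolded pos_def_on_def, THEN spec[of _ b], THEN mp])
      (simp add: mult_le_0_iff)
  then show "\<forall>\<phi>\<in>msets n K. a \<phi> = 0"
    by (simp add: b_def)
qed

text \<open>Pairing with multinomials acts on coefficient vectors as the Gram matrix, which turns
  questions about duals into linear systems.\<close>

lemma has_bochner_integral_multinom_mult_poly:
  assumes "n \<ge> 1" "\<psi> \<in> msets n L"
  shows "has_bochner_integral (simplex_measure n)
    (\<lambda>r. multinom n \<psi> r * (\<lambda>r\<in>simplex_set n. \<Sum>\<phi>\<in>msets n K. a \<phi> * multinom n \<phi> r) r)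
    (\<Sum>\<phi>\<in>msets n K. multinom_gram n \<psi> \<phi> * a \<phi>)"
proof -
  have "has_bochner_integral (simplex_measure n)
      (\<lambda>r. \<Sum>\<phi>\<in>msets n K. multinom n \<psi> r * multinom n \<phi> r * a \<phi>)
      (\<Sum>\<phi>\<in>msets n K. multinom_gram n \<psi> \<phi> * a \<phi>)"
    by (intro has_bochner_integral_sum has_bochner_integral_mult_left
        has_bochner_integral_multinom_mult[OF assms])
  also have "?this \<longleftrightarrow> ?thesis"
    by (intro has_bochner_integral_cong) (simp_all add: sum_distrib_left mult_ac)
  finally show ?thesis .
qed

lemma integrable_multinom_mult_poly:
  assumes "n \<ge> 1" "\<psi> \<in> msets n L" "f \<in> simplex_polys n K"
  shows "integrable (simplex_measure n) (\<lambda>r. multinom n \<psi> r * f r)"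
  using assms(3) has_bochner_integral_multinom_mult_poly[OF assms(1,2)]
  by (auto simp: simplex_polys_def has_bochner_integral_iff)

section \<open>Existence and uniqueness of the dual multinomials\<close>

text \<open>The difference of the coefficient vectors lies in the kernel of the Gram matrix, hence
  is zero. This yields both the uniqueness of the duals and the value of their sum.\<close>

lemma simplex_polys_eqI:
  assumes "n \<ge> 1" and f: "f \<in> simplex_polys n K" and g: "g \<in> simplex_polys n K"
    and eq: "\<And>\<phi>. \<phi> \<in> msets n K \<Longrightarrow>
      simplex_inner n (multinom n \<phi>) f = simplex_inner n (multinom n \<phi>) g"
  shows "f = g"
proof -
  obtain a b where a: "f = (\<lambda>r\<in>simplex_set n. \<Sum>\<phi>\<in>msets n K. a \<phi> * multinom n \<phi> r)"
    and b: "g = (\<lambda>r\<in>simplex_set n. \<Sum>\<phi>\<in>msets n K. b \<phi> * multinom n \<phi> r)"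
    using f g by (auto simp: simplex_polys_def)
  have "(\<Sum>\<psi>\<in>msets n K. multinom_gram n \<phi> \<psi> * a \<psi>) = (\<Sum>\<psi>\<in>msets n K. multinom_gram n \<phi> \<psi> * b \<psi>)"
    if "\<phi> \<in> msets n K" for \<phi>
    using eq[OF that]
    unfolding a b simplex_inner_def
      has_bochner_integral_multinom_mult_poly[OF assms(1) that, THEN has_bochner_integral_integral_eq] .
  then have "(\<Sum>\<psi>\<in>msets n K. multinom_gram n \<phi> \<psi> * (a \<psi> - b \<psi>)) = 0" if "\<phi> \<in> msets n K" for \<phi>
    using that by (simp add: right_diff_distrib sum_subtractf)
  then have "(\<Sum>\<phi>\<in>msets n K. \<Sum>\<psi>\<in>msets n K. (a \<phi> - b \<phi>) * multinom_gram n \<phi> \<psi> * (a \<psi> - b \<psi>)) = 0"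
    by (simp only: mult.assoc sum_distrib_left[symmetric]) simp
  then have "\<forall>\<phi>\<in>msets n K. a \<phi> - b \<phi> = 0"
    by (intro pos_def_on_multinom_gram[unfolded pos_def_on_def, THEN spec[of _ "\<lambda>\<phi>. a \<phi> - b \<phi>"], THEN mp])
      simp
  then show ?thesis
    unfolding a b by (intro restrict_ext sum.cong) auto
qed

text \<open>The coefficients of the dual solve the Gram system whose right-hand side is the unit
  vector at \<upsilon>. With uniqueness, the description \<open>THE d\<close> in
  \<open>dual_multinom\<close> denotes this solution.\<close>

lemma
  assumes "n \<ge> 1" "\<upsilon> \<in> msets n K"
  shows dual_multinom_in_simplex_polys: "dual_multinom n \<upsilon> \<in> simplex_polys n K"
    and inner_multinom_dual_multinom: "\<phi> \<in> msets n K \<Longrightarrow>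
      simplex_inner n (multinom n \<phi>) (dual_multinom n \<upsilon>) = (if \<phi> = \<upsilon> then 1 else 0)"
proof -
  have size: "size \<upsilon> = K"
    using assms(2) by (simp add: msets_def)
  let ?P = "\<lambda>d. d \<in> simplex_polys n K \<and> (\<forall>\<phi>\<in>msets n K.
      simplex_inner n (multinom n \<phi>) d = (if \<phi> = \<upsilon> then 1 else 0))"
  obtain a where a: "(\<Sum>\<psi>\<in>msets n K. multinom_gram n \<phi> \<psi> * a \<psi>) = (if \<phi> = \<upsilon> then 1 else 0)"
    if "\<phi> \<in> msets n K" for \<phi>
    using pos_def_on_solve[OF finite_msets pos_def_on_multinom_gram, of n K "\<lambda>\<phi>. if \<phi> = \<upsilon> then 1 else 0"]
    by auto
  have "?P (\<lambda>r\<in>simplex_set n. \<Sum>\<phi>\<in>msets n K. a \<phi> * multinom n \<phi> r)"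
    using has_bochner_integral_multinom_mult_poly[OF assms(1), of _ K, THEN has_bochner_integral_integral_eq] a
    by (auto simp: simplex_polys_def simplex_inner_def)
  moreover have "d = e" if "?P d" "?P e" for d e
    using that by (intro simplex_polys_eqI[OF assms(1)]) auto
  ultimately have "\<exists>!d. ?P d"
    by blast
  from theI'[OF this] have "?P (dual_multinom n \<upsilon>)"
    unfolding dual_multinom_def size .
  then show "dual_multinom n \<upsilon> \<in> simplex_polys n K" "\<phi> \<in> msets n K \<Longrightarrow>
      simplex_inner n (multinom n \<phi>) (dual_multinom n \<upsilon>) = (if \<phi> = \<upsilon> then 1 else 0)"
    by auto
qed

section \<open>Sums of dual multinomials and of hypergeometric values\<close>

text \<open>The multinomials sum to 1, so equal coefficients \<open>c\<close> represent the
  constant.\<close>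

lemma simplex_polys_const: "(\<lambda>r\<in>simplex_set n. c) \<in> simplex_polys n K"
proof -
  have "(\<lambda>r\<in>simplex_set n. c) = (\<lambda>r\<in>simplex_set n. \<Sum>\<phi>\<in>msets n K. c * multinom n \<phi> r)"
    by (intro restrict_ext) (simp add: sum_multinom flip: sum_distrib_left)
  then show ?thesis
    unfolding simplex_polys_def by (intro CollectI exI[of _ "\<lambda>_. c"])
qed

lemma simplex_polys_sum:
  assumes "\<And>x. x \<in> X \<Longrightarrow> f x \<in> simplex_polys n K"
  shows "(\<lambda>r\<in>simplex_set n. \<Sum>x\<in>X. f x r) \<in> simplex_polys n K"
proof -
  have "\<forall>x\<in>X. \<exists>a. f x = (\<lambda>r\<in>simplex_set n. \<Sum>\<phi>\<in>msets n K. a \<phi> * multinom n \<phi> r)"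
    using assms by (auto simp: simplex_polys_def)
  then obtain a where a: "\<And>x. x \<in> X \<Longrightarrow>
      f x = (\<lambda>r\<in>simplex_set n. \<Sum>\<phi>\<in>msets n K. a x \<phi> * multinom n \<phi> r)"
    by metis
  have "(\<lambda>r\<in>simplex_set n. \<Sum>x\<in>X. f x r) =
      (\<lambda>r\<in>simplex_set n. \<Sum>\<phi>\<in>msets n K. (\<Sum>x\<in>X. a x \<phi>) * multinom n \<phi> r)"
  proof (intro restrict_ext)
    fix r assume "r \<in> simplex_set n"
    then have "(\<Sum>x\<in>X. f x r) = (\<Sum>x\<in>X. \<Sum>\<phi>\<in>msets n K. a x \<phi> * multinom n \<phi> r)"
      by (intro sum.cong) (simp_all add: a)
    also have "\<dots> = (\<Sum>\<phi>\<in>msets n K. (\<Sum>x\<in>X. a x \<phi>) * multinom n \<phi> r)"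
      unfolding sum_distrib_right by (rule sum.swap)
    finally show "(\<Sum>x\<in>X. f x r) = (\<Sum>\<phi>\<in>msets n K. (\<Sum>x\<in>X. a x \<phi>) * multinom n \<phi> r)" .
  qed
  then show ?thesis
    unfolding simplex_polys_def by (intro CollectI exI)
qed

lemma integrable_multinom_mult_dual:
  assumes "n \<ge> 1" "\<psi> \<in> msets n L" "\<phi> \<in> msets n K"
  shows "integrable (simplex_measure n) (\<lambda>r. multinom n \<psi> r * dual_multinom n \<phi> r)"
  using integrable_multinom_mult_poly[OF assms(1,2) dual_multinom_in_simplex_polys[OF assms(1,3)]] .

text \<open>Both sides have inner product \<open>1\<close> with every multinomial.\<close>

lemma sum_dual_multinom:
  assumes "n \<ge> 1" "r \<in> simplex_set n"
  shows "(\<Sum>\<phi>\<in>msets n K. dual_multinom n \<phi> r) = fact (K + n - 1) / fact K"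
proof -
  have "(\<lambda>r\<in>simplex_set n. \<Sum>\<phi>\<in>msets n K. dual_multinom n \<phi> r) =
      (\<lambda>r\<in>simplex_set n. fact (K + n - 1) / fact K)"
  proof (rule simplex_polys_eqI[OF assms(1)])
    show "(\<lambda>r\<in>simplex_set n. \<Sum>\<phi>\<in>msets n K. dual_multinom n \<phi> r) \<in> simplex_polys n K"
      by (intro simplex_polys_sum dual_multinom_in_simplex_polys assms(1))
    show "(\<lambda>r\<in>simplex_set n. fact (K + n - 1) / fact K) \<in> simplex_polys n K"
      by (rule simplex_polys_const)
    fix \<psi> assume \<psi>: "\<psi> \<in> msets n K"
    have "simplex_inner n (multinom n \<psi>) (\<lambda>r\<in>simplex_set n. \<Sum>\<phi>\<in>msets n K. dual_multinom n \<phi> r) =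
        simplex_integral n (\<lambda>r. \<Sum>\<phi>\<in>msets n K. multinom n \<psi> r * dual_multinom n \<phi> r)"
      unfolding simplex_inner_def
      by (intro Bochner_Integration.integral_cong) (simp_all add: sum_distrib_left)
    also have "\<dots> = (\<Sum>\<phi>\<in>msets n K. simplex_inner n (multinom n \<psi>) (dual_multinom n \<phi>))"
      unfolding simplex_inner_def
      by (intro Bochner_Integration.integral_sum integrable_multinom_mult_dual[OF assms(1) \<psi>])
    \<comment> \<open>Duality leaves only the summand at \<psi>; the constant on the other side is
      the reciprocal of the mass of a multinomial.\<close>
    also have "\<dots> = 1"
      using \<psi> by (simp add: inner_multinom_dual_multinom[OF assms(1)])
    also have "\<dots> = simplex_integral n (\<lambda>r. multinom n \<psi> r * (fact (K + n - 1) / fact K))"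
      by (simp add: integral_multinom[OF assms(1) \<psi>])
    also have "\<dots> = simplex_inner n (multinom n \<psi>) (\<lambda>r\<in>simplex_set n. fact (K + n - 1) / fact K)"
      unfolding simplex_inner_def by (intro Bochner_Integration.integral_cong) simp_all
    finally show "simplex_inner n (multinom n \<psi>)
        (\<lambda>r\<in>simplex_set n. \<Sum>\<phi>\<in>msets n K. dual_multinom n \<phi> r) =
      simplex_inner n (multinom n \<psi>) (\<lambda>r\<in>simplex_set n. fact (K + n - 1) / fact K)" .
  qed
  from fun_cong[OF this, of r] show ?thesis
    using assms(2) by simp
qed

text \<open>The multinomials of size \<open>L\<close> are a partition of unity on the simplex, so
  summing over draws leaves the total mass of the dual Dirichlet measure.\<close>

lemma sum_shg_draws_eq_integral:
  assumes "n \<ge> 1" "\<phi> \<in> msets n K"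
  shows "(\<Sum>\<psi>\<in>msets n L. shg n \<phi> \<psi>) = simplex_integral n (dual_multinom n \<phi>)"
proof -
  have "(\<Sum>\<psi>\<in>msets n L. shg n \<phi> \<psi>) =
      simplex_integral n (\<lambda>r. \<Sum>\<psi>\<in>msets n L. multinom n \<psi> r * dual_multinom n \<phi> r)"
    unfolding shg_def
    by (intro Bochner_Integration.integral_sum[symmetric]
        integrable_multinom_mult_dual[OF assms(1) _ assms(2)])
  also have "\<dots> = simplex_integral n (dual_multinom n \<phi>)"
    by (intro Bochner_Integration.integral_cong)
      (simp_all add: sum_multinom flip: sum_distrib_right)
  finally show ?thesis .
qed

text \<open>The sum does not depend on \<open>L\<close>, and for \<open>L = K\<close> duality evaluates it.\<close>

lemma sum_shg_draws:
  assumes "n \<ge> 1" "\<phi> \<in> msets n K"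
  shows "(\<Sum>\<psi>\<in>msets n L. shg n \<phi> \<psi>) = 1"
proof -
  have "(\<Sum>\<psi>\<in>msets n L. shg n \<phi> \<psi>) = (\<Sum>\<psi>\<in>msets n K. shg n \<phi> \<psi>)"
    by (simp only: sum_shg_draws_eq_integral[OF assms])
  also have "\<dots> = (\<Sum>\<psi>\<in>msets n K. if \<psi> = \<phi> then 1 else 0)"
    using inner_multinom_dual_multinom[OF assms]
    by (intro sum.cong) (auto simp: shg_def simplex_inner_def)
  finally show ?thesis
    using assms(2) by simp
qed

text \<open>Summing over urns makes the duals constant and leaves the mass of one multinomial. This
  supplies the normalisation of \<open>dmn_dir\<close>.\<close>

lemma sum_shg_urns:
  assumes "n \<ge> 1" "\<psi> \<in> msets n L"
  shows "(\<Sum>\<phi>\<in>msets n K. shg n \<phi> \<psi>) =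
    fact L / fact (L + n - 1) * (fact (K + n - 1) / fact K)"
proof -
  have "(\<Sum>\<phi>\<in>msets n K. shg n \<phi> \<psi>) =
      simplex_integral n (\<lambda>r. \<Sum>\<phi>\<in>msets n K. multinom n \<psi> r * dual_multinom n \<phi> r)"
    unfolding shg_def
    by (intro Bochner_Integration.integral_sum[symmetric] integrable_multinom_mult_dual[OF assms])
  also have "\<dots> = simplex_integral n (\<lambda>r. multinom n \<psi> r * (fact (K + n - 1) / fact K))"
    using assms(1) by (intro Bochner_Integration.integral_cong)
      (simp_all add: sum_dual_multinom flip: sum_distrib_left)
  also have "\<dots> = fact L / fact (L + n - 1) * (fact (K + n - 1) / fact K)"
    by (simp add: integral_multinom[OF assms])
  finally show ?thesis .
qed

section \<open>The Dirichlet channel and Bayesian inversion\<close>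

text \<open>Adding \<open>mset_one n\<close> undoes the exponent shift in the Dirichlet density, so
  only the normalising constants differ.\<close>

lemma dir_mset_one_add:
  assumes "n \<ge> 1" "\<psi> \<in> msets n L" "r \<in> simplex_set n"
  shows "dir n (mset_one n + \<psi>) r = fact (L + n - 1) / fact L * multinom n \<psi> r"
proof -
  have "size (mset_one n + \<psi>) - 1 = L + n - 1"
    using assms(2) by (simp add: mset_one_def msets_def add.commute)
  moreover have "(\<Prod>i<n. r i ^ (count (mset_one n + \<psi>) i - 1)) = (\<Prod>i<n. r i ^ count \<psi> i)"
    by (intro prod.cong) (auto simp: mset_one_def)
  ultimately show ?thesis
    by (simp add: dir_def multinom_eq[OF assms(3,2)])
qed

lemma dmn_dir_eq_shg:
  assumes "n \<ge> 1" "\<psi> \<in> msets n L"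
  shows "dmn_dir n K \<psi> \<phi> = fact K / fact (K + n - 1) * (fact (L + n - 1) / fact L) * shg n \<phi> \<psi>"
proof -
  have "dmn_dir n K \<psi> \<phi> = simplex_integral n (\<lambda>r.
      fact K / fact (K + n - 1) * (fact (L + n - 1) / fact L)
        * (multinom n \<psi> r * dual_multinom n \<phi> r))"
    unfolding dmn_dir_def
    by (intro Bochner_Integration.integral_cong) (simp_all add: dmn_def dir_mset_one_add[OF assms])
  then show ?thesis
    \<comment> \<open>The default integral 0 of a non-integrable function is compatible with
      scaling, so every \<phi> is covered.\<close>
    unfolding shg_def by (simp only: integral_mult_right_zero)
qed

text \<open>In this form the ratio of the cardinalities for \<open>L\<close> and \<open>K\<close> is
  the constant of \<open>dmn_dir_eq_shg\<close>, with \<open>fact (n - 1)\<close>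
  cancelling.\<close>

lemma real_card_msets:
  assumes "n \<ge> 1"
  shows "real (card (msets n K)) = fact (K + n - 1) / (fact K * fact (n - 1))"
  using assms by (simp add: card_msets binomial_fact add.commute)

theorem theorem18:
  fixes n K L :: nat
  assumes "n \<ge> 1"
  shows "signed_channel (msets n L) (msets n K) (dmn_dir n K)
    \<and> signed_channel (msets n K) (msets n L) (shg n)
    \<and> (\<forall>\<phi>\<in>msets n K. \<forall>\<psi>\<in>msets n L.
         joint (uniform (msets n K)) (shg n) (\<phi>, \<psi>) =
         joint (uniform (msets n L)) (dmn_dir n K) (\<psi>, \<phi>))
    \<and> (\<forall>\<phi>\<in>msets n K. \<forall>\<psi>\<in>msets n L.
         1 / real ((n + K - 1) choose K) *
           simplex_integral n (\<lambda>r. multinom n \<psi> r * dual_multinom n \<phi> r) =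
         1 / real ((n + L - 1) choose L) * dmn_dir n K \<psi> \<phi>)
    \<and> dagger_defined (msets n L) (msets n K) (dmn_dir n K) (uniform (msets n L))
    \<and> (\<forall>\<phi>\<in>msets n K. \<forall>\<psi>\<in>msets n L.
         shg n \<phi> \<psi> = dagger (msets n L) (dmn_dir n K) (uniform (msets n L)) \<phi> \<psi>)"
proof -
  let ?u = "\<lambda>K. 1 / real (card (msets n K))"
  have joint: "?u K * shg n \<phi> \<psi> = ?u L * dmn_dir n K \<psi> \<phi>" if "\<psi> \<in> msets n L" for \<phi> \<psi>
    using that assms by (simp add: real_card_msets dmn_dir_eq_shg)
  \<comment> \<open>By \<open>joint\<close> this is a marginal of the distribution that draws a
    uniform urn and then applies \<open>shg\<close>, so the pushforward is again uniform. This gives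
    the nonzero denominator of the dagger.\<close>
  have push: "channel_push (msets n L) (dmn_dir n K) (uniform (msets n L)) \<phi> = ?u K"
    if "\<phi> \<in> msets n K" for \<phi>
  proof -
    have "channel_push (msets n L) (dmn_dir n K) (uniform (msets n L)) \<phi> =
        (\<Sum>\<psi>\<in>msets n L. ?u K * shg n \<phi> \<psi>)"
      unfolding channel_push_def uniform_def by (intro sum.cong refl joint[symmetric])
    then show ?thesis
      by (simp only: sum_distrib_left[symmetric] sum_shg_draws[OF assms that] mult_1_right)
  qed
  have "?u K \<noteq> 0"
    using assms by (simp add: real_card_msets)
  \<comment> \<open>The constants of \<open>dmn_dir_eq_shg\<close> and \<open>sum_shg_urns\<close>
    are reciprocal.\<close>
  have "(\<Sum>\<phi>\<in>msets n K. dmn_dir n K \<psi> \<phi>) = 1" if "\<psi> \<in> msets n L" for \<psi>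
    using that assms
    by (simp add: dmn_dir_eq_shg sum_shg_urns flip: sum_distrib_left sum_divide_distrib)
  then have "signed_channel (msets n L) (msets n K) (dmn_dir n K)"
    by (simp add: signed_channel_def signed_distribution_def)
  moreover have "signed_channel (msets n K) (msets n L) (shg n)"
    using assms by (simp add: signed_channel_def signed_distribution_def sum_shg_draws)
  moreover have "joint (uniform (msets n K)) (shg n) (\<phi>, \<psi>) =
      joint (uniform (msets n L)) (dmn_dir n K) (\<psi>, \<phi>)" if "\<psi> \<in> msets n L" for \<phi> \<psi>
    using joint[OF that] by (simp add: joint_def uniform_def)
  moreover have "1 / real ((n + K - 1) choose K) *
        simplex_integral n (\<lambda>r. multinom n \<psi> r * dual_multinom n \<phi> r) =
      1 / real ((n + L - 1) choose L) * dmn_dir n K \<psi> \<phi>" if "\<psi> \<in> msets n L" for \<phi> \<psi>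
    using joint[OF that] by (simp only: card_msets shg_def)
  moreover have "dagger_defined (msets n L) (msets n K) (dmn_dir n K) (uniform (msets n L))"
    using push \<open>?u K \<noteq> 0\<close> by (simp add: dagger_defined_def)
  moreover have "shg n \<phi> \<psi> = dagger (msets n L) (dmn_dir n K) (uniform (msets n L)) \<phi> \<psi>"
    if "\<phi> \<in> msets n K" "\<psi> \<in> msets n L" for \<phi> \<psi>
    unfolding dagger_def push[OF that(1)] using joint[OF that(2)] \<open>?u K \<noteq> 0\<close>
    by (simp add: uniform_def field_simps)
  ultimately show ?thesis
    by blast
qed

end
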